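(* Let $k$ be a positive integer, and write $Q=4^k$ and $q=Q^3$. If $a\in\mathbb{F}_q^*$ is a $(Q-1)$-th power in $\mathbb{F}_q^*$ but not a $3(Q-1)$-th power in $\mathbb{F}_q^*$, then the function $c\mapsto a c^{Q^2+Q}$ is planar on $\mathbb{F}_q$.
   Context: For $q$ a power of $2$, a function $F\colon\mathbb{F}_q\to\mathbb{F}_q$ is called planar if, for every $d\in\mathbb{F}_q^*$, the function $c\mapsto F(c+d)+F(c)+dc$ is a bijection on $\mathbb{F}_q$. *)

theory Defs
  imports "HOL-Library.Cardinality"
begin

text \<open>
  The notion of planarity for fields of even order; in odd characteristic the word has a
  different meaning. The predicate is only meant to be used when the order of the field \<open>'a\<close>
  is a power of 2.
\<close>

definition planar :: "('a::{field,finite} \<Rightarrow> 'a) \<Rightarrow> bool" where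
  "planar F \<longleftrightarrow> (\<forall>d. d \<noteq> 0 \<longrightarrow> bij (\<lambda>c. F (c + d) + F c + d * c))"

end

theory Submission
  imports Defs
begin

text \<open>
  Since \<open>F(c) = a c\<^bsup>Q\<^sup>2+Q\<^esup>\<close> is a quadratic form, planarity says that no
  nonzero \<open>c, d\<close> satisfy \<open>a (c\<^bsup>Q\<^sup>2\<^esup> d\<^sup>Q + c\<^sup>Q d\<^bsup>Q\<^sup>2\<^esup>) = d c\<close>. With \<open>c = d e\<close> and
  \<open>A = a d\<^bsup>(Q-1)(Q+2)\<^esup> = x\<^bsup>1-Q\<^esup>\<close> this reads \<open>e = A (e\<^sup>Q + e\<^bsup>Q\<^sup>2\<^esup>)\<close>. This equation and its two
  conjugates form a linear system whose determinant vanishes exactly when \<open>(x, y, z) =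
  (x, x\<^sup>Q, x\<^bsup>Q\<^sup>2\<^esup>)\<close> lies on the nodal cubic \<open>x\<^sup>2y + y\<^sup>2z + z\<^sup>2x + xyz = 0\<close>. In the coordinates
  \<open>u = x + \<omega>y + \<omega>\<^sup>2z\<close>, \<open>v = x + \<omega>\<^sup>2y + \<omega>z\<close>, \<open>t = x + y + z\<close> (\<open>\<omega>\<close> a primitive cube root of
  unity, written \<open>w\<close> below) the cubic is \<open>\<omega>u\<^sup>3 + \<omega>\<^sup>2v\<^sup>3 + uvt = 0\<close>, and its rational parametrization
  gives \<open>uv x = s\<^bsup>2Q+1\<^esup>\<close> with \<open>s = u + \<omega>\<^sup>2v\<close> and \<open>uv\<close> in the field of order \<open>Q\<close>. As
  \<open>2Q+1\<close> and \<open>Q+2\<close> are divisible by 3, \<open>a\<close> would be a \<open>3(Q-1)\<close>-th power.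
\<close>

section \<open>Finite fields and characteristic 2\<close>

lemma finite_field_power_card_eq_same:
  fixes x :: "'a::{field,finite}"
  shows "x ^ CARD('a) = x"
proof (cases "x = 0")
  case False
  define N where "N = UNIV - {0::'a}"
  have "(\<Prod>y\<in>N. x * y) = \<Prod>N"
    by (rule prod.reindex_bij_witness[where i = "\<lambda>y. y / x" and j = "(*) x"])
      (use False in \<open>simp_all add: N_def\<close>)
  then have "x ^ card N * \<Prod>N = \<Prod>N"
    by (simp add: prod.distrib)
  moreover have "\<Prod>N \<noteq> 0"
    by (simp add: N_def)
  ultimately have "x ^ card N = 1"
    by simp
  moreover have "CARD('a) = Suc (card N)"
    unfolding N_def by (rule card_Suc_Diff1[symmetric]) simp_all
  ultimately show ?thesis
    by simp
qed simp

lemma finite_field_even_card_one_add_one: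
  assumes "even CARD('a::{field,finite})"
  shows "1 + 1 = (0::'a)"
proof -
  have "(-1::'a) ^ CARD('a) = -1"
    by (rule finite_field_power_card_eq_same)
  then show ?thesis
    using assms by simp
qed

lemma char2_add_eq_0_iff:
  fixes x y :: "'a::comm_ring_1"
  assumes "1 + 1 = (0::'a)"
  shows "x + y = 0 \<longleftrightarrow> x = y"
proof -
  have "y + y = 0"
    using assms by (metis distrib_left mult_1_right mult_zero_right)
  then show ?thesis
    by (metis add_right_cancel)
qed

text \<open>Together with \<open>algebra_simps\<close> these rules normalize polynomials in characteristic 2.\<close>

lemma char2_cancel:
  fixes x y :: "'a::comm_ring_1"
  assumes "1 + 1 = (0::'a)"
  shows "x + x = 0" "x + (x + y) = y"
  using char2_add_eq_0_iff[OF assms, of x x] by (simp_all flip: add.assoc)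

lemmas polynomial_simps = algebra_simps power2_eq_square power3_eq_cube mult_1 mult_1_right
  add_0 add_0_right

lemma char2_power_add:
  fixes x y :: "'a::comm_ring_1"
  assumes "1 + 1 = (0::'a)"
  shows "(x + y) ^ (2 ^ n) = x ^ (2 ^ n) + y ^ (2 ^ n)"
proof (induction n)
  case (Suc n)
  have sq: "(u + v)\<^sup>2 = u\<^sup>2 + v\<^sup>2" for u v :: 'a
    by (simp only: polynomial_simps char2_cancel[OF assms])
  show ?case
    by (simp only: power_Suc2 power_mult Suc sq)
qed simp

text \<open>On a finite field a non-cube makes cubing non-surjective, hence non-injective; the
  quotient of two distinct elements with equal cubes is the root sought.\<close>

lemma cube_root_of_unity_exists:
  fixes b :: "'a::{field,finite}"
  assumes "\<And>c. b \<noteq> c ^ 3"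
  obtains w :: 'a where "w\<^sup>2 + w + 1 = 0"
proof -
  have "\<not> inj (\<lambda>c::'a. c ^ 3)"
    using assms finite_UNIV_inj_surj[of "\<lambda>c::'a. c ^ 3"] by (metis finite surjD)
  then obtain c d :: 'a where cd: "c ^ 3 = d ^ 3" "c \<noteq> d"
    unfolding inj_def by blast
  then have d: "d \<noteq> 0"
    by auto
  have "(c - d) * (c\<^sup>2 + c * d + d\<^sup>2) = 0"
    using cd(1) by algebra
  then have "c\<^sup>2 + c * d + d\<^sup>2 = 0"
    using cd(2) by simp
  then have "(c / d)\<^sup>2 + c / d + 1 = 0"
    using d by (simp add: field_simps power2_eq_square)
  then show thesis
    by (rule that)
qed

section \<open>The nodal cubic\<close>

lemma conjugate_system_cubic:
  fixes x y z e f g :: "'a::field"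
  assumes "1 + 1 = (0::'a)" "e \<noteq> 0"
    and "y * e = x * (f + g)" "z * f = y * (g + e)" "x * g = z * (e + f)"
  shows "x\<^sup>2 * y + y\<^sup>2 * z + z\<^sup>2 * x + x * y * z = 0"
proof -
  \<comment> \<open>Cramer's rule: the coefficients are the cofactors of the column of \<open>e\<close>.\<close>
  have "e * (x\<^sup>2 * y + y\<^sup>2 * z + z\<^sup>2 * x + x * y * z) =
      (z * x + y * z) * (y * e + x * (f + g)) + (x\<^sup>2 + x * z) * (z * f + y * (g + e))
      + (x * y + x * z) * (x * g + z * (e + f))"
    by (simp only: polynomial_simps char2_cancel[OF assms(1)])
  also have "\<dots> = 0"
    by (simp only: assms(3-5) char2_cancel[OF assms(1)] mult_zero_right add_0)
  finally have "e * (x\<^sup>2 * y + y\<^sup>2 * z + z\<^sup>2 * x + x * y * z) = 0" .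
  then show ?thesis
    using assms(2) by simp
qed

lemma nodal_cubic_cube:
  fixes x w :: "'a::field"
  assumes two: "1 + 1 = (0::'a)" and w: "w\<^sup>2 + w + 1 = 0"
    and Q: "Q = 2 ^ n" "Q mod 3 = 1" and x0: "x \<noteq> 0" and xQ: "x ^ (Q ^ 3) = x"
    and cubic: "x\<^sup>2 * x ^ Q + (x ^ Q)\<^sup>2 * x ^ (Q\<^sup>2) + (x ^ (Q\<^sup>2))\<^sup>2 * x + x * x ^ Q * x ^ (Q\<^sup>2) = 0"
  obtains s where "s \<noteq> 0" "x ^ (Q - 1) = s ^ (3 * (Q - 1))"
proof -
  define y z where "y = x ^ Q" and "z = x ^ (Q\<^sup>2)"
  define u v where "u = x + w * y + w\<^sup>2 * z" and "v = x + w\<^sup>2 * y + w * z"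
  define s where "s = u + w\<^sup>2 * v"
  have Q0: "Q > 0"
    using Q(1) by simp
  have add: "(p + r) ^ Q = p ^ Q + r ^ Q" for p r :: 'a
    unfolding Q(1) by (rule char2_power_add[OF two])
  have ww: "w * w = w + 1"
    using w char2_add_eq_0_iff[OF two, of "w * w" "w + 1"]
    by (simp add: power2_eq_square add.assoc)
  then have www: "w * (w * t) = w * t + t" for t
    by (metis distrib_right mult.assoc mult_1)
  note normalize = polynomial_simps ww www char2_cancel[OF two]
  have w3: "w ^ 3 = 1"
    by (simp only: normalize)
  have "Q = 3 * (Q div 3) + 1"
    using Q(2) by presburger
  then have wQ: "w ^ Q = w"
    by (metis power_add power_mult power_one power_one_right mult_1 w3)
  have zQ: "z ^ Q = x"
    using xQ by (simp add: z_def power_mult[symmetric] numeral_3_eq_3 power2_eq_square mult.assoc)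
  have yQ: "y ^ Q = z"
    by (simp add: y_def z_def power_mult[symmetric] power2_eq_square)
  have w2Q: "(w\<^sup>2) ^ Q = w\<^sup>2"
    by (metis power_commutes power_mult mult.commute wQ)
  \<comment> \<open>The \<open>Q\<close>-power map fixes \<open>w\<close> and cycles
    \<open>x\<close>, \<open>y\<close>, \<open>z\<close>, so \<open>u\<close> and \<open>v\<close>
    are eigenvectors of it.\<close>
  have "u ^ Q = y + w * z + w\<^sup>2 * x"
    by (simp add: u_def add power_mult_distrib wQ w2Q yQ zQ flip: y_def)
  also have "\<dots> = w\<^sup>2 * u"
    by (simp only: u_def normalize)
  finally have uQ: "u ^ Q = w\<^sup>2 * u" .
  have "v ^ Q = y + w\<^sup>2 * z + w * x"
    by (simp add: v_def add power_mult_distrib wQ w2Q yQ zQ flip: y_def)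
  also have "\<dots> = w * v"
    by (simp only: v_def normalize)
  finally have vQ: "v ^ Q = w * v" .
  have cubic': "x\<^sup>2 * y + y\<^sup>2 * z + z\<^sup>2 * x + x * y * z = 0"
    using cubic by (simp add: y_def z_def)
  have "w * u ^ 3 + w\<^sup>2 * v ^ 3 + u * v * (x + y + z)
      = x\<^sup>2 * y + y\<^sup>2 * z + z\<^sup>2 * x + x * y * z"
    by (simp only: u_def v_def normalize)
  then have uvw: "w * u ^ 3 + w\<^sup>2 * v ^ 3 = u * v * (x + y + z)"
    by (simp add: cubic' char2_add_eq_0_iff[OF two])
  have yz: "y + z = u + v" and xz: "x + z = w\<^sup>2 * u + w * v"
    by (simp_all only: u_def v_def normalize)
  have w0: "w \<noteq> 0"
    using w3 by auto
  show thesis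
  proof (cases "u = 0 \<or> v = 0")
    case True
    \<comment> \<open>The cubic forces the node \<open>x = y = z\<close>; then \<open>x\<close> lies
      in the field of order \<open>Q\<close>, and 1 is the witness.\<close>
    then have "u = 0" "v = 0"
      using uvw w0 by auto
    then have "y + z = 0" "x + z = 0"
      using yz xz by simp_all
    then have "y = x"
      by (simp add: char2_add_eq_0_iff[OF two])
    then have "x * x ^ (Q - 1) = x"
      using Q0 by (simp add: y_def flip: power_Suc)
    then have "x ^ (Q - 1) = 1 ^ (3 * (Q - 1))"
      using x0 by simp
    then show thesis
      by (rule that[rotated]) simp
  next
    case False
    have sQ: "s ^ Q = w\<^sup>2 * (u + w * v)"
      by (simp add: s_def add power_mult_distrib w2Q uQ vQ distrib_left)
    \<comment> \<open>As \<open>x = (y + z) + (x + y + z)\<close>, the cubic turns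
      \<open>x * (u * v)\<close> into a binary form in \<open>u\<close> and \<open>v\<close>, which
      factors through \<open>s\<close> and its conjugate.\<close>
    have "x * (u * v) = (u + v) * (u * v) + u * v * (x + y + z)"
      by (simp only: yz[symmetric] normalize)
    also have "\<dots> = s * (s ^ Q)\<^sup>2"
      unfolding sQ uvw[symmetric] by (simp only: s_def normalize)
    also have "\<dots> = s ^ (2 * Q + 1)"
      by (simp add: power_mult[symmetric] mult.commute)
    also have "2 * Q + 1 = (2 * Q + 1) div 3 * 3"
      using Q(2) by presburger
    finally have xuv: "x * (u * v) = (s ^ ((2 * Q + 1) div 3)) ^ 3"
      by (simp only: power_mult)
    \<comment> \<open>The eigenvalues of \<open>u\<close> and \<open>v\<close> multiply to 1, so
      \<open>u * v\<close> drops out of \<open>(Q - 1)\<close>-th powers.\<close>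
    have "u * v * (u * v) ^ (Q - 1) = (u * v) ^ Q"
      using Q0 by (simp flip: power_Suc)
    also have "\<dots> = u * v"
      using w3 by (simp add: power_mult_distrib uQ vQ) algebra
    finally have "(u * v) ^ (Q - 1) = 1"
      using False by simp
    then have "x ^ (Q - 1) = (x * (u * v)) ^ (Q - 1)"
      by (simp add: power_mult_distrib)
    also have "\<dots> = (s ^ ((2 * Q + 1) div 3)) ^ (3 * (Q - 1))"
      by (simp only: xuv power_mult)
    finally show thesis
      using that xuv x0 False by (metis mult_eq_0_iff zero_power zero_less_numeral)
  qed
qed

section \<open>Reduction of planarity to the cubic\<close>

lemma planar_kernel_trivial:
  fixes a b c d w :: "'a::field"
  assumes two: "1 + 1 = (0::'a)" and w: "w\<^sup>2 + w + 1 = 0"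
    and Q: "Q = 2 ^ n" "Q mod 3 = 1" and card: "\<And>x::'a. x ^ (Q ^ 3) = x"
    and b: "b \<noteq> 0" "a = b ^ (Q - 1)"
    and a: "\<not> (\<exists>b::'a. b \<noteq> 0 \<and> a = b ^ (3 * (Q - 1)))"
    and d: "d \<noteq> 0" and eq: "a * (c ^ (Q\<^sup>2) * d ^ Q + c ^ Q * d ^ (Q\<^sup>2)) = d * c"
  shows "c = 0"
proof (rule ccontr)
  assume c: "c \<noteq> 0"
  define e where "e = c / d"
  \<comment> \<open>A \<open>(Q - 1)\<close>-th root of \<open>1 / A\<close>, available because
    \<open>a = b ^ (Q - 1)\<close>.\<close>
  define x where "x = 1 / (b * d ^ (Q + 2))"
  have Q0: "Q > 0"
    using Q(1) by simp
  have x0: "x \<noteq> 0"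
    using b d by (simp add: x_def)
  have e0: "e \<noteq> 0"
    using c d by (simp add: e_def)
  have add: "(p + r) ^ Q = p ^ Q + r ^ Q" for p r :: 'a
    unfolding Q(1) by (rule char2_power_add[OF two])
  have Q2: "(p ^ Q) ^ Q = p ^ (Q\<^sup>2)" for p :: 'a
    by (simp add: power_mult[symmetric] power2_eq_square)
  have Q3: "(p ^ (Q\<^sup>2)) ^ Q = p" for p :: 'a
    using card[of p] by (simp add: power_mult[symmetric] numeral_3_eq_3 power2_eq_square mult.assoc)
  have aux: "b ^ Q = b * a"
    using b Q0 by (simp flip: power_Suc)
  have xQ: "x ^ Q * (a * (d ^ Q * d ^ (Q\<^sup>2))) = x * d\<^sup>2"
  proof -
    have "x ^ Q = 1 / (b * a * (d ^ (Q\<^sup>2) * (d ^ Q)\<^sup>2))"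
      by (simp add: x_def power_mult_distrib power_divide aux power_add power2_eq_square Q2[symmetric]
          flip: power_mult)
    moreover have "a \<noteq> 0"
      using b by simp
    ultimately show ?thesis
      using b d by (simp add: x_def field_simps power_add power2_eq_square)
  qed
  have ce: "c = d * e"
    using d by (simp add: e_def)
  have "d\<^sup>2 * e = a * (d ^ Q * d ^ (Q\<^sup>2)) * (e ^ Q + e ^ (Q\<^sup>2))"
    using eq unfolding ce by (simp add: power_mult_distrib algebra_simps power2_eq_square)
  then have "d\<^sup>2 * (x ^ Q * e) = x ^ Q * (a * (d ^ Q * d ^ (Q\<^sup>2))) * (e ^ Q + e ^ (Q\<^sup>2))"
    by (simp only: mult.left_commute[of "d\<^sup>2"] mult.assoc)
  also have "\<dots> = d\<^sup>2 * (x * (e ^ Q + e ^ (Q\<^sup>2)))"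
    unfolding xQ by (simp only: mult_ac)
  finally have "d\<^sup>2 * (x ^ Q * e) = d\<^sup>2 * (x * (e ^ Q + e ^ (Q\<^sup>2)))" .
  then have e1: "x ^ Q * e = x * (e ^ Q + e ^ (Q\<^sup>2))"
    using d by simp
  have e2: "x ^ (Q\<^sup>2) * e ^ Q = x ^ Q * (e ^ (Q\<^sup>2) + e)"
    using arg_cong[OF e1, of "\<lambda>t. t ^ Q"] by (simp add: power_mult_distrib add Q2 Q3)
  have e3: "x * e ^ (Q\<^sup>2) = x ^ (Q\<^sup>2) * (e + e ^ Q)"
    using arg_cong[OF e2, of "\<lambda>t. t ^ Q"] by (simp add: power_mult_distrib add Q2 Q3)
  obtain s where s: "s \<noteq> 0" "x ^ (Q - 1) = s ^ (3 * (Q - 1))"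
    using nodal_cubic_cube[OF two w Q x0 card conjugate_system_cubic[OF two e0 e1 e2 e3]] .
  \<comment> \<open>Since 3 divides \<open>Q + 2\<close>, \<open>b\<close> equals
    \<open>1 / x\<close> up to a cube, so \<open>a\<close> becomes a \<open>3 * (Q - 1)\<close>-th
    power.\<close>
  define m where "m = (Q + 2) div 3"
  have m: "Q + 2 = m * 3"
    unfolding m_def using Q(2) by presburger
  have "b * (d ^ m) ^ 3 * x = 1"
    using b d unfolding x_def m by (simp add: power_mult)
  then have "(b * (d ^ m) ^ 3 * x) ^ (Q - 1) = 1"
    by simp
  then have "a * (d ^ m * s) ^ (3 * (Q - 1)) = 1"
    unfolding b(2) power_mult_distrib s(2) by (simp only: power_mult[symmetric] mult.assoc)
  then have "a = (1 / (d ^ m * s)) ^ (3 * (Q - 1))"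
    using s d by (simp add: power_divide field_simps)
  moreover have "1 / (d ^ m * s) \<noteq> 0"
    using s d by simp
  ultimately show False
    using a by blast
qed

theorem theorem1:
  fixes k Q q :: nat and a :: "'a::{field,finite}"
  assumes "k > 0"
    and "Q = 4 ^ k"
    and "q = Q ^ 3"
    and "CARD('a) = q"
    and "a \<noteq> 0"
    and "\<exists>b::'a. b \<noteq> 0 \<and> a = b ^ (Q - 1)"
    and "\<not> (\<exists>b::'a. b \<noteq> 0 \<and> a = b ^ (3 * (Q - 1)))"
  shows "planar (\<lambda>c::'a. a * c ^ (Q ^ 2 + Q))"
  unfolding planar_def
proof (intro allI impI)
  fix d :: 'a
  assume d: "d \<noteq> 0"
  have two: "1 + 1 = (0::'a)"
    using assms(1-4) by (intro finite_field_even_card_one_add_one) simp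
  have Q: "Q = 2 ^ (2 * k)"
    by (simp add: assms(2) power_mult)
  have "(4::nat) ^ k mod 3 = 1"
    using power_mod[of "4::nat" 3 k] by simp
  then have Q3: "Q mod 3 = 1"
    by (simp add: assms(2))
  have card: "x ^ (Q ^ 3) = x" for x :: 'a
    using finite_field_power_card_eq_same[of x] assms(3,4) by simp
  obtain b where b: "b \<noteq> 0" "a = b ^ (Q - 1)"
    using assms(6) by blast
  \<comment> \<open>The hypothesis on \<open>a\<close> itself supplies the non-cube that yields
    \<open>w\<close>.\<close>
  have "b \<noteq> c ^ 3" for c
    using assms(7) b by (metis power_mult zero_power zero_less_numeral)
  then obtain w :: 'a where w: "w\<^sup>2 + w + 1 = 0"
    using cube_root_of_unity_exists by blast
  have add: "(x + y) ^ Q = x ^ Q + y ^ Q" for x y :: 'a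
    unfolding Q by (rule char2_power_add[OF two])
  have add2: "(x + y) ^ (Q\<^sup>2) = x ^ (Q\<^sup>2) + y ^ (Q\<^sup>2)" for x y :: 'a
    by (simp add: power2_eq_square power_mult add)
  have "inj (\<lambda>c. a * (c + d) ^ (Q\<^sup>2 + Q) + a * c ^ (Q\<^sup>2 + Q) + d * c)"
  proof (rule injI)
    fix x y
    assume "a * (x + d) ^ (Q\<^sup>2 + Q) + a * x ^ (Q\<^sup>2 + Q) + d * x
      = a * (y + d) ^ (Q\<^sup>2 + Q) + a * y ^ (Q\<^sup>2 + Q) + d * y"
    \<comment> \<open>Adding the two values cancels the terms in \<open>d\<close> alone; the rest is
      additive in the argument, so only \<open>x + y\<close> enters.\<close>
    then have "a * ((x + y) ^ (Q\<^sup>2) * d ^ Q + (x + y) ^ Q * d ^ (Q\<^sup>2)) = d * (x + y)"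
      by (subst char2_add_eq_0_iff[OF two, symmetric],
          subst (asm) char2_add_eq_0_iff[OF two, symmetric])
        (simp only: power_add add add2 algebra_simps char2_cancel[OF two])
    then have "x + y = 0"
      by (rule planar_kernel_trivial[OF two w Q Q3 card b assms(7) d])
    then show "x = y"
      by (simp only: char2_add_eq_0_iff[OF two])
  qed
  then show "bij (\<lambda>c. a * (c + d) ^ (Q\<^sup>2 + Q) + a * c ^ (Q\<^sup>2 + Q) + d * c)"
    by (simp add: bij_def finite_UNIV_inj_surj)
qed

end
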